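(* Let $K$ be a field of characteristic zero, and let $L$ be the two-dimensional non-abelian Lie algebra over $K$ with basis $\{x,y\}$ and bracket $[x,y]_L=y$. Let $U(L)$ be its universal enveloping algebra with multiplication $\cdot_0$, and let $U^k(L)=(U(L),*,\alpha_k)$ be the hom-associative universal enveloping algebra of $L$, where $\alpha_k(y^mx^n)=k^my^mx^n$ and $a*b=\alpha_k(a\cdot_0 b)$. Then the deformation of $U(L)$ into $U^k(L)$ (with parameter $t:=k-1$ regarded as an indeterminate) induces a one-parameter formal hom-Lie deformation of the Lie algebra of $U(L)$ into the hom-Lie algebra of $U^k(L)$, using the commutator as bracket. Explicitly: let $\alpha_t$ be the $K\llbracket t\rrbracket$-linear map on $U(L)\llbracket t\rrbracket$ and $\cdot_t$ the $K\llbracket t\rrbracket$-bilinear operation on $U(L)\llbracket t\rrbracket$ obtained from $\alpha_k$ and $*$ by substituting $k=1+t$. That is, $\alpha_t(y^mx^n)=(1+t)^my^mx^n$ for all $m,n\in\mathbb{N}_0$ and $a\cdot_t b=\alpha_t(a\cdot_0 b)$ for all $a,b\in U(L)$, both extended homogeneously. Let $[a,b]_t:=a\cdot_t b-b\cdot_t a$ for $a,b\in U(L)\llbracket t\rrbracket$, and let $[a,b]_0:=a\cdot_0 b-b\cdot_0 a$ for $a,b\in U(L)$. Then $(U(L)\llbracket t\rrbracket,[\cdot,\cdot]_t,\alpha_t)$ is a one-parameter formal hom-Lie deformation of the Lie algebra $(U(L),[\cdot,\cdot]_0,\mathrm{id}_{U(L)})$ over $K$.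
   Context: **Hom-Lie algebras.** A hom-Lie algebra over an associative, commutative, unital ring $R$ is a triple $(M,[\cdot,\cdot],\alpha)$ where $M$ is an $R$-module, $\alpha\colon M\to M$ is an $R$-linear map (the twisting map), and $[\cdot,\cdot]\colon M\times M\to M$ is an $R$-bilinear map with $[u,u]=0$ for all $u\in M$ and $[\alpha(u),[v,w]]+[\alpha(w),[u,v]]+[\alpha(v),[w,u]]=0$ for all $u,v,w\in M$ (hom-Jacobi identity). A Lie algebra is regarded as a hom-Lie algebra with twisting map the identity. **Hom-associative algebras and commutators.** A hom-associative algebra over $R$ is a triple $(M,\cdot,\alpha)$ with $M$ an $R$-module, $\cdot$ an $R$-bilinear operation on $M$ and $\alpha\colon M\to M$ an $R$-linear map such that $\alpha(a)\cdot(b\cdot c)=(a\cdot b)\cdot\alpha(c)$ for all $a,b,c\in M$. Its (hom-)Lie algebra is $(M,[\cdot,\cdot],\alpha)$ with $[a,b]=a\cdot b-b\cdot a$. **Power series and homogeneous extension.** For an $R$-module $M$, $M\llbracket t\rrbracket$ denotes the $R\llbracket t\rrbracket$-module of formal power series $\sum_{j\ge 0}m_jt^j$ with $m_j\in M$. An $R$-linear map $f\colon M\to M$ is extended homogeneously to $M\llbracket t\rrbracket$ by $f(\sum_j m_jt^j)=\sum_j f(m_j)t^j$. An $R$-bilinear operation $\star$ on $M$ is extended homogeneously by $(\sum_j m_jt^j)\star(\sum_l n_lt^l)=\sum_{j,l}(m_j\star n_l)t^{j+l}$. If $\alpha_i$ ($i\in\mathbb{N}_0$) are $R$-linear maps $M\to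 M$, then $\sum_{i}\alpha_it^i$ denotes the $R\llbracket t\rrbracket$-linear map on $M\llbracket t\rrbracket$ given by $u\mapsto\sum_i\alpha_i(u)t^i$, and similarly for a sequence of bilinear operations. An $R$-linear map $M\to M\llbracket t\rrbracket$, $m\mapsto\sum_i\alpha_i(m)t^i$, is thus extended homogeneously to $M\llbracket t\rrbracket$ by extending each $\alpha_i$, and similarly for bilinear maps. **One-parameter formal hom-Lie deformation.** A one-parameter formal hom-Lie deformation of a hom-Lie algebra $(M,[\cdot,\cdot]_0,\alpha_0)$ over $R$ is a hom-Lie algebra $(M\llbracket t\rrbracket,[\cdot,\cdot]_t,\alpha_t)$ over $R\llbracket t\rrbracket$ with $[\cdot,\cdot]_t=\sum_{i=0}^\infty[\cdot,\cdot]_i\,t^i$ and $\alpha_t=\sum_{i=0}^\infty\alpha_it^i$. Here each $[\cdot,\cdot]_i\colon M\times M\to M$ is an $R$-bilinear operation and each $\alpha_i\colon M\to M$ is an $R$-linear map, all extended homogeneously to $M\llbracket t\rrbracket$, and the $i=0$ terms are the given $[\cdot,\cdot]_0$ and $\alpha_0$. **Universal enveloping algebras.** $U(L)$ is the unital associative $K$-algebra $K\langle x,y\rangle/(xy-yx-y)$. Equivalently, it is the Ore extension $K[y][x;\mathrm{id}_{K[y]},\delta]$ with $\delta=y\frac{\mathrm{d}}{\mathrm{d}y}$. It has $K$-basis $\{y^mx^n: m,n\in\mathbb{N}_0\}$. For $k\in K^\times$, $\alpha_k$ is the $K$-linear map on $U(L)$ with $\alpha_k(y^mx^n)=k^my^mx^n$,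 and $U^k(L)$ is the hom-associative algebra $(U(L),*,\alpha_k)$ with $a*b:=\alpha_k(a\cdot_0 b)$. "The deformation of $U(L)$ into $U^k(L)$" means the triple $(U(L)\llbracket t\rrbracket,\cdot_t,\alpha_t)$ obtained by substituting $k=1+t$. *)

theory Defs
  imports
    "HOL-Library.Poly_Mapping"
    "HOL-Computational_Algebra.Formal_Power_Series"
begin

unbundle fps_syntax

section \<open>Hom-Lie algebras\<close>

locale hom_lie_algebra = module scale
  for scale :: "'r::comm_ring_1 \<Rightarrow> 'm::ab_group_add \<Rightarrow> 'm" +
  fixes bracket :: "'m \<Rightarrow> 'm \<Rightarrow> 'm"
    and twist :: "'m \<Rightarrow> 'm"
  assumes linear_twist: "module_hom scale scale twist"
    and linear_bracket_left: "module_hom scale scale (\<lambda>u. bracket u v)"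
    and linear_bracket_right: "module_hom scale scale (bracket u)"
    and bracket_self: "bracket u u = 0"
    and hom_jacobi:
      "bracket (twist u) (bracket v w) + bracket (twist w) (bracket u v)
        + bracket (twist v) (bracket w u) = 0"

definition commutator :: "('m::ab_group_add \<Rightarrow> 'm \<Rightarrow> 'm) \<Rightarrow> 'm \<Rightarrow> 'm \<Rightarrow> 'm"
  where "commutator f a b = f a b - f b a"


section \<open>Power series over a module and homogeneous extension\<close>

text \<open>The type \<open>'m fps\<close> serves as the set of power series with coefficients in any module;
  the action of \<open>'r fps\<close> on it is the convolution below.\<close>

definition fps_scale ::
  "('r::comm_ring_1 \<Rightarrow> 'm::ab_group_add \<Rightarrow> 'm) \<Rightarrow> 'r fps \<Rightarrow> 'm fps \<Rightarrow> 'm fps"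
  where "fps_scale scale f u = Abs_fps (\<lambda>n. \<Sum>i\<le>n. scale (f $ i) (u $ (n - i)))"

text \<open>A linear map \<open>F\<close> from \<open>M\<close> to \<open>M[[t]]\<close> has components \<open>\<lambda>m. F m $ i\<close>.  Its homogeneous
  extension sends \<open>\<Sum>\<^sub>j m\<^sub>j t\<^sup>j\<close> to \<open>\<Sum>\<^sub>i\<^sub>,\<^sub>j (F m\<^sub>j $ i) t\<^sup>i\<^sup>+\<^sup>j\<close>, and a bilinear operation is extended in
  the same way in both arguments.\<close>

definition hom_ext :: "('m::ab_group_add \<Rightarrow> 'm fps) \<Rightarrow> 'm fps \<Rightarrow> 'm fps"
  where "hom_ext F u = Abs_fps (\<lambda>n. \<Sum>j\<le>n. F (u $ j) $ (n - j))"

definition hom_ext2 :: "('m::ab_group_add \<Rightarrow> 'm \<Rightarrow> 'm fps) \<Rightarrow> 'm fps \<Rightarrow> 'm fps \<Rightarrow> 'm fps"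
  where "hom_ext2 B u v =
    Abs_fps (\<lambda>n. \<Sum>j\<le>n. \<Sum>l\<le>n - j. B (u $ j) (v $ l) $ (n - j - l))"

definition formal_hom_lie_deformation ::
  "('r::comm_ring_1 \<Rightarrow> 'm::ab_group_add \<Rightarrow> 'm) \<Rightarrow> ('m \<Rightarrow> 'm \<Rightarrow> 'm) \<Rightarrow> ('m \<Rightarrow> 'm)
    \<Rightarrow> ('m fps \<Rightarrow> 'm fps \<Rightarrow> 'm fps) \<Rightarrow> ('m fps \<Rightarrow> 'm fps) \<Rightarrow> bool"
  where "formal_hom_lie_deformation scale bracket\<^sub>0 twist\<^sub>0 bracket\<^sub>t twist\<^sub>t \<longleftrightarrow>
    hom_lie_algebra scale bracket\<^sub>0 twist\<^sub>0 \<and>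
    hom_lie_algebra (fps_scale scale) bracket\<^sub>t twist\<^sub>t \<and>
    (\<exists>brackets :: nat \<Rightarrow> 'm \<Rightarrow> 'm \<Rightarrow> 'm. \<exists>twists :: nat \<Rightarrow> 'm \<Rightarrow> 'm.
      (\<forall>i u. module_hom scale scale (brackets i u)) \<and>
      (\<forall>i v. module_hom scale scale (\<lambda>u. brackets i u v)) \<and>
      (\<forall>i. module_hom scale scale (twists i)) \<and>
      brackets 0 = bracket\<^sub>0 \<and> twists 0 = twist\<^sub>0 \<and>
      bracket\<^sub>t = hom_ext2 (\<lambda>u v. Abs_fps (\<lambda>i. brackets i u v)) \<and>
      twist\<^sub>t = hom_ext (\<lambda>u. Abs_fps (\<lambda>i. twists i u)))"


section \<open>The free algebra on two generators\<close>

datatype generator = gen_x | gen_y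

datatype word = Word (letters: "generator list")

instantiation word :: monoid_add
begin

definition zero_word :: word
  where "zero_word = Word []"

definition plus_word :: "word \<Rightarrow> word \<Rightarrow> word"
  where "plus_word v w = Word (letters v @ letters w)"

instance
  by standard (auto simp: zero_word_def plus_word_def)

end

text \<open>Words form an additively written monoid under concatenation, so its monoid algebra
  over \<open>'k\<close> is the free algebra.\<close>

type_synonym 'k free_alg = "word \<Rightarrow>\<^sub>0 'k"

definition free_gen :: "generator \<Rightarrow> 'k::field free_alg"
  where "free_gen g = Poly_Mapping.single (Word [g]) 1"

inductive_set two_sided_ideal :: "'a::ring_1 set \<Rightarrow> 'a set" for S :: "'a set"
  where
    generator: "r \<in> S \<Longrightarrow> r \<in> two_sided_ideal S"
  | zero: "0 \<in> two_sided_ideal S"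
  | add: "p \<in> two_sided_ideal S \<Longrightarrow> q \<in> two_sided_ideal S \<Longrightarrow> p + q \<in> two_sided_ideal S"
  | mult_left: "p \<in> two_sided_ideal S \<Longrightarrow> a * p \<in> two_sided_ideal S"
  | mult_right: "p \<in> two_sided_ideal S \<Longrightarrow> p * a \<in> two_sided_ideal S"

lemma two_sided_ideal_uminus: "p \<in> two_sided_ideal S \<Longrightarrow> - p \<in> two_sided_ideal S"
  using two_sided_ideal.mult_left[of p S "-1"] by simp

lemma two_sided_ideal_diff:
  "p \<in> two_sided_ideal S \<Longrightarrow> q \<in> two_sided_ideal S \<Longrightarrow> p - q \<in> two_sided_ideal S"
  using two_sided_ideal.add[OF _ two_sided_ideal_uminus, of p S q] by simp

definition rel_ideal :: "'k::field free_alg set"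
  where "rel_ideal =
    two_sided_ideal
      {free_gen gen_x * free_gen gen_y - free_gen gen_y * free_gen gen_x - free_gen gen_y}"

lemma lookup_mult_empty_word:
  fixes p q :: "'k::field free_alg"
  shows "Poly_Mapping.lookup (p * q) 0 = Poly_Mapping.lookup p 0 * Poly_Mapping.lookup q 0"
proof -
  have eq: "(0::word) = v + w \<longleftrightarrow> v = 0 \<and> w = 0" for v w :: word
    by (cases v; cases w) (auto simp: zero_word_def plus_word_def)
  have "(Poly_Mapping.lookup q w when 0 = v + w) =
      ((Poly_Mapping.lookup q w when v = 0) when w = 0)" for v w
    by (simp add: when_def eq)
  then have "Poly_Mapping.lookup (p * q) 0 =
      (\<Sum>v. Poly_Mapping.lookup p v * (Poly_Mapping.lookup q 0 when v = 0))"
    by (simp only: lookup_mult Sum_any_when_equal)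
  also have "\<dots> = Poly_Mapping.lookup p 0 * Poly_Mapping.lookup q 0"
    by (simp only: mult_when Sum_any_when_equal)
  finally show ?thesis .
qed

lemma rel_ideal_const: "p \<in> rel_ideal \<Longrightarrow> Poly_Mapping.lookup p 0 = 0"
  unfolding rel_ideal_def
proof (induction rule: two_sided_ideal.induct)
  case (generator r)
  have "Poly_Mapping.lookup (free_gen g :: 'a free_alg) 0 = 0" for g
    by (simp add: free_gen_def lookup_single zero_word_def)
  with generator show ?case
    by (simp add: lookup_minus lookup_mult_empty_word)
qed (simp_all add: lookup_add lookup_mult_empty_word)

lemma free_alg_induct [case_names zero single add]:
  fixes p :: "'k::field free_alg"
  assumes "P 0" "\<And>w c. P (Poly_Mapping.single w c)"
    and "\<And>p q. P p \<Longrightarrow> P q \<Longrightarrow> P (p + q)"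
  shows "P p"
proof (induction p rule: update_induct)
  case const
  show ?case by fact
next
  case (update p w c)
  have "Poly_Mapping.update w c p = p + Poly_Mapping.single w c"
    by (rule poly_mapping_eqI)
      (use update(1) in \<open>auto simp: lookup_add lookup_single lookup_update in_keys_iff when_def\<close>)
  then show ?case using assms update by simp
qed

lemma single_zero_commute:
  fixes p :: "'k::field free_alg"
  shows "Poly_Mapping.single 0 c * p = p * Poly_Mapping.single 0 c"
  by (induction p rule: free_alg_induct)
    (simp_all add: mult_single mult.commute[of c] distrib_left distrib_right)


section \<open>The universal enveloping algebra of the two-dimensional non-abelian Lie algebra\<close>

quotient_type (overloaded) 'k env_alg = "'k::field free_alg" / "\<lambda>p q. p - q \<in> rel_ideal"
proof (rule equivpI)
  show "reflp (\<lambda>p q. p - q \<in> (rel_ideal :: 'k free_alg set))"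
    by (auto intro: reflpI simp: rel_ideal_def two_sided_ideal.zero)
  show "symp (\<lambda>p q. p - q \<in> (rel_ideal :: 'k free_alg set))"
    unfolding rel_ideal_def by (rule sympI, drule two_sided_ideal_uminus) simp
  show "transp (\<lambda>p q. p - q \<in> (rel_ideal :: 'k free_alg set))"
    unfolding rel_ideal_def by (rule transpI, drule (1) two_sided_ideal.add) simp
qed

instantiation env_alg :: (field) ring_1
begin

lift_definition zero_env_alg :: "'a env_alg" is 0 .

lift_definition one_env_alg :: "'a env_alg" is 1 .

lift_definition plus_env_alg :: "'a env_alg \<Rightarrow> 'a env_alg \<Rightarrow> 'a env_alg" is "(+)"
  unfolding rel_ideal_def by (drule (1) two_sided_ideal.add) (simp add: algebra_simps)

lift_definition uminus_env_alg :: "'a env_alg \<Rightarrow> 'a env_alg" is uminus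
  unfolding rel_ideal_def by (drule two_sided_ideal_uminus) (simp add: algebra_simps)

lift_definition minus_env_alg :: "'a env_alg \<Rightarrow> 'a env_alg \<Rightarrow> 'a env_alg" is "(-)"
  unfolding rel_ideal_def by (drule (1) two_sided_ideal_diff) (simp add: algebra_simps)

lift_definition times_env_alg :: "'a env_alg \<Rightarrow> 'a env_alg \<Rightarrow> 'a env_alg" is "(*)"
proof -
  fix p p' q q' :: "'a free_alg"
  assume "p - p' \<in> rel_ideal" "q - q' \<in> rel_ideal"
  then have "(p - p') * q + p' * (q - q') \<in> rel_ideal"
    unfolding rel_ideal_def
    by (intro two_sided_ideal.add two_sided_ideal.mult_left two_sided_ideal.mult_right)
  then show "p * q - p' * q' \<in> rel_ideal"
    by (simp add: algebra_simps)
qed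

instance
proof
  have zero: "(0 :: 'a free_alg) \<in> rel_ideal"
    by (simp add: rel_ideal_def two_sided_ideal.zero)
  fix a b c :: "'a env_alg"
  show "a + b + c = a + (b + c)" by transfer (simp add: zero algebra_simps)
  show "a + b = b + a" by transfer (simp add: zero)
  show "0 + a = a" by transfer (simp add: zero)
  show "- a + a = 0" by transfer (simp add: zero)
  show "a - b = a + - b" by transfer (simp add: zero)
  show "a * b * c = a * (b * c)" by transfer (simp add: zero mult.assoc)
  show "(a + b) * c = a * c + b * c" by transfer (simp add: zero algebra_simps)
  show "a * (b + c) = a * b + a * c" by transfer (simp add: zero algebra_simps)
  show "1 * a = a" by transfer (simp add: zero)
  show "a * 1 = a" by transfer (simp add: zero)
  show "(0 :: 'a env_alg) \<noteq> 1"
    by transfer (auto dest!: rel_ideal_const simp: lookup_minus)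
qed

end

lift_definition env_scale :: "'k::field \<Rightarrow> 'k env_alg \<Rightarrow> 'k env_alg"
  is "\<lambda>c p. Poly_Mapping.map ((*) c) p"
  unfolding rel_ideal_def mult_map_scale_conv_mult right_diff_distrib[symmetric]
  by (rule two_sided_ideal.mult_left)

lift_definition env_gen :: "generator \<Rightarrow> 'k::field env_alg" is free_gen .

definition env_basis :: "nat \<Rightarrow> nat \<Rightarrow> 'k::field env_alg"
  where "env_basis m n = env_gen gen_y ^ m * env_gen gen_x ^ n"

lemma env_relation:
  "env_gen gen_x * env_gen gen_y - env_gen gen_y * env_gen gen_x =
    (env_gen gen_y :: 'k::field env_alg)"
  by transfer (simp add: rel_ideal_def two_sided_ideal.generator)

lemma env_scale_left: "env_scale c (a * b) = env_scale c a * b"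
  by transfer (simp add: mult_map_scale_conv_mult mult.assoc rel_ideal_def two_sided_ideal.zero)

lemma env_scale_right: "env_scale c (a * b) = a * env_scale c b"
proof transfer
  fix c :: 'a and p q :: "'a free_alg"
  have "Poly_Mapping.single 0 c * (p * q) = p * (Poly_Mapping.single 0 c * q)"
    by (simp only: mult.assoc[symmetric] single_zero_commute[of c p])
  then show "Poly_Mapping.map ((*) c) (p * q) - p * Poly_Mapping.map ((*) c) q \<in> rel_ideal"
    by (simp add: mult_map_scale_conv_mult rel_ideal_def two_sided_ideal.zero)
qed

lemma module_env_scale: "module (env_scale :: 'k::field \<Rightarrow> _)"
proof
  have zero: "(0 :: 'k free_alg) \<in> rel_ideal"
    by (simp add: rel_ideal_def two_sided_ideal.zero)
  fix a b :: 'k and x y :: "'k env_alg"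
  show "env_scale a (x + y) = env_scale a x + env_scale a y"
    by transfer (simp add: mult_map_scale_conv_mult zero algebra_simps)
  show "env_scale (a + b) x = env_scale a x + env_scale b x"
    by transfer (simp add: mult_map_scale_conv_mult single_add zero algebra_simps)
  show "env_scale a (env_scale b x) = env_scale (a * b) x"
    by transfer (simp add: mult_map_scale_conv_mult zero mult_single flip: mult.assoc)
  show "env_scale 1 x = x"
    by transfer (simp add: mult_map_scale_conv_mult zero)
qed


subsection \<open>Homomorphisms out of the algebra, and spanning by ordered monomials\<close>

lemma env_alg_cases: obtains p where "u = abs_env_alg p"
  by (induct u rule: env_alg.abs_induct) blast

locale free_alg_hom =
  fixes h :: "'k::field \<Rightarrow> 'a::ring_1" and g :: "generator \<Rightarrow> 'a"
  assumes h_add: "h (c + d) = h c + h d" and h_mult: "h (c * d) = h c * h d"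
    and h_one: "h 1 = 1" and h_commute: "h c * a = a * h c"
    and relation: "g gen_x * g gen_y - g gen_y * g gen_x - g gen_y = 0"
begin

definition ev :: "'k free_alg \<Rightarrow> 'a"
  where "ev p = (\<Sum>w. h (Poly_Mapping.lookup p w) * prod_list (map g (letters w)))"

lemma h_zero: "h 0 = 0"
  using h_add[of 0 0] by simp

lemma finite_ev: "finite {w. h (Poly_Mapping.lookup p w) * a w \<noteq> 0}"
  by (rule finite_subset[of _ "Poly_Mapping.keys p"]) (auto simp: h_zero in_keys_iff)

lemma ev_add: "ev (p + q) = ev p + ev q"
  unfolding ev_def lookup_add h_add distrib_right by (rule Sum_any.distrib) (rule finite_ev)+

lemma ev_single: "ev (Poly_Mapping.single w c) = h c * prod_list (map g (letters w))"
proof -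
  have "h (Poly_Mapping.lookup (Poly_Mapping.single w c) v) * prod_list (map g (letters v)) =
     (h c * prod_list (map g (letters v)) when v = w)" for v
    by (auto simp: lookup_single when_def h_zero)
  then show ?thesis by (simp add: ev_def)
qed

lemma ev_zero: "ev 0 = 0"
  using ev_add[of 0 0] by simp

lemma ev_diff: "ev (p - q) = ev p - ev q"
  using ev_add[of "p - q" q] by (simp add: algebra_simps)

lemma ev_mult: "ev (p * q) = ev p * ev q"
proof (induction p rule: free_alg_induct)
  case (single v c)
  show ?case
  proof (induction q rule: free_alg_induct)
    case (single w d)
    have "h c * h d * (a * b) = h c * a * (h d * b)" for a b
      by (simp only: mult.assoc[symmetric]) (simp only: mult.assoc h_commute[of d a])
    then show ?case by (simp add: mult_single ev_single plus_word_def h_mult)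
  qed (simp_all add: ev_zero ev_add distrib_left)
qed (simp_all add: ev_zero ev_add distrib_right)

lemma ev_ideal: "p \<in> rel_ideal \<Longrightarrow> ev p = 0"
  unfolding rel_ideal_def
proof (induction rule: two_sided_ideal.induct)
  case (generator r)
  then show ?case using relation
    by (simp add: ev_diff ev_mult) (simp add: free_gen_def ev_single h_one)
qed (simp_all add: ev_zero ev_add ev_mult)

definition hom :: "'k env_alg \<Rightarrow> 'a"
  where "hom u = ev (rep_env_alg u)"

lemma hom_abs: "hom (abs_env_alg p) = ev p"
proof -
  have "rep_env_alg (abs_env_alg p) - p \<in> rel_ideal"
    by (rule Quotient3_rep_abs[OF Quotient3_env_alg])
      (simp add: rel_ideal_def two_sided_ideal.zero)
  from ev_ideal[OF this] show ?thesis by (simp add: hom_def ev_diff)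
qed

lemma hom_add: "hom (a + b) = hom a + hom b"
  by (cases a rule: env_alg_cases; cases b rule: env_alg_cases)
    (simp add: plus_env_alg.abs_eq hom_abs ev_add)

lemma hom_mult: "hom (a * b) = hom a * hom b"
  by (cases a rule: env_alg_cases; cases b rule: env_alg_cases)
    (simp add: times_env_alg.abs_eq hom_abs ev_mult)

lemma hom_scale: "hom (env_scale c a) = h c * hom a"
  by (cases a rule: env_alg_cases)
    (simp add: env_scale.abs_eq mult_map_scale_conv_mult hom_abs ev_mult ev_single zero_word_def)

lemma hom_gen: "hom (env_gen x) = g x"
  by (simp add: env_gen.abs_eq free_gen_def hom_abs ev_single h_one)

lemma hom_one: "hom 1 = 1"
  by (simp add: one_env_alg.abs_eq hom_abs ev_single h_one zero_word_def flip: single_one)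

lemma hom_power: "hom (a ^ n) = hom a ^ n"
  by (induction n) (simp_all add: hom_one hom_mult)

end

inductive_set env_span :: "'k::field env_alg set" where
  basis: "env_scale c (env_basis m n) \<in> env_span"
| add: "u \<in> env_span \<Longrightarrow> v \<in> env_span \<Longrightarrow> u + v \<in> env_span"

interpretation env: module env_scale by (rule module_env_scale)

lemma env_span_scale: "u \<in> env_span \<Longrightarrow> env_scale c u \<in> env_span"
  by (induction rule: env_span.induct) (auto intro: env_span.intros simp: env.scale_right_distrib)

lemma gen_x_gen_y_power: "env_gen gen_x * env_gen gen_y ^ m =
  env_gen gen_y ^ m * env_gen gen_x + env_scale (of_nat m) (env_gen gen_y ^ m :: 'k::field env_alg)"
proof (induction m)
  case (Suc m)
  let ?x = "env_gen gen_x :: 'k env_alg" and ?y = "env_gen gen_y :: 'k env_alg"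
  have r: "?x * ?y = ?y * ?x + ?y" using env_relation by (simp add: algebra_simps)
  have "?x * ?y ^ Suc m = ?y * (?x * ?y ^ m) + ?y ^ Suc m"
    by (simp add: r distrib_right flip: mult.assoc)
  also have "\<dots> = ?y ^ Suc m * ?x + env_scale (of_nat (Suc m)) (?y ^ Suc m)"
    unfolding Suc
    by (simp add: distrib_left mult.assoc env_scale_right[symmetric] env.scale_left_distrib)
  finally show ?case .
qed simp

lemma env_span_gen: "u \<in> env_span \<Longrightarrow> env_gen a * u \<in> env_span"
proof (induction rule: env_span.induct)
  case (basis c m n)
  show ?case
  proof (cases a)
    case gen_y
    have "env_gen a * env_scale c (env_basis m n) = env_scale c (env_basis (Suc m) n)"
      by (simp add: gen_y env_basis_def mult.assoc flip: env_scale_right)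
    then show ?thesis by (simp add: env_span.basis)
  next
    case gen_x
    have "env_gen a * env_scale c (env_basis m n) =
        env_scale c (env_gen gen_x * env_gen gen_y ^ m * env_gen gen_x ^ n)"
      by (simp add: gen_x env_basis_def mult.assoc flip: env_scale_right)
    also have "\<dots> = env_scale c (env_basis m (Suc n)) + env_scale (c * of_nat m) (env_basis m n)"
      by (simp add: gen_x_gen_y_power env_basis_def distrib_right mult.assoc env.scale_right_distrib
          flip: env_scale_left)
    finally show ?thesis by (simp add: env_span.intros)
  qed
qed (simp add: distrib_left env_span.add)

lemma env_span: "(u :: 'k::field env_alg) \<in> env_span"
proof (cases u rule: env_alg_cases)
  case (1 p)
  have w: "abs_env_alg (Poly_Mapping.single (Word ws) 1) \<in> (env_span :: 'k env_alg set)" for ws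
  proof (induction ws)
    case Nil
    have "abs_env_alg (Poly_Mapping.single (Word []) 1) = env_scale 1 (env_basis 0 0 :: 'k env_alg)"
      by (simp add: env_basis_def flip: zero_word_def one_env_alg.abs_eq)
    then show ?case by (simp only: env_span.basis)
  next
    case (Cons a ws)
    have "abs_env_alg (Poly_Mapping.single (Word (a # ws)) 1) =
        (env_gen a :: 'k env_alg) * abs_env_alg (Poly_Mapping.single (Word ws) 1)"
      by (simp add: env_gen.abs_eq times_env_alg.abs_eq free_gen_def mult_single plus_word_def)
    with env_span_gen[OF Cons] show ?case by simp
  qed
  have "abs_env_alg p \<in> env_span"
  proof (induction p rule: free_alg_induct)
    case zero
    show ?case using env_span_scale[OF w[of "[]"], of 0]
      by (simp flip: zero_env_alg.abs_eq)
  next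
    case (single v c)
    have "abs_env_alg (Poly_Mapping.single v c) =
        env_scale c (abs_env_alg (Poly_Mapping.single v 1))"
      by (simp add: env_scale.abs_eq mult_map_scale_conv_mult mult_single)
    then show ?case using w[of "letters v"] by (simp add: env_span_scale)
  next
    case (add p q)
    then show ?case by (simp add: env_span.add flip: plus_env_alg.abs_eq)
  qed
  then show ?thesis by (simp add: 1)
qed

lemma env_ext:
  assumes F: "module_hom env_scale s F" and G: "module_hom env_scale s G"
    and eq: "\<And>m n. F (env_basis m n) = G (env_basis m n)"
  shows "F = G"
proof
  interpret F: module_hom env_scale s F by fact
  interpret G: module_hom env_scale s G by fact
  fix u show "F u = G u" using env_span[of u]
    by (induction rule: env_span.induct) (simp_all add: F.add G.add F.scale G.scale eq)
qed

lemma fps_scale_mult: "fps_scale env_scale f u = Abs_fps (\<lambda>n. env_scale (f $ n) 1) * u"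
  by (simp add: fps_eq_iff fps_scale_def fps_mult_nth atLeast0AtMost flip: env_scale_left)

lemma module_fps_const: "module (\<lambda>c. fps_scale env_scale (fps_const (c :: 'k::field)))"
  and fps_const_scale:
    "fps_scale env_scale (fps_const (c :: 'k::field)) u = Abs_fps (\<lambda>n. env_scale c (u $ n))"
proof -
  show *: "fps_scale env_scale (fps_const (c :: 'k::field)) u = Abs_fps (\<lambda>n. env_scale c (u $ n))"
    for c u
    by (simp add: fps_eq_iff fps_scale_def if_distrib[of "\<lambda>c. env_scale c _"] sum.delta cong: if_cong)
  show "module (\<lambda>c. fps_scale env_scale (fps_const (c :: 'k::field)))"
    by standard (simp_all only: * fps_eq_iff fps_nth_Abs_fps fps_add_nth env.scale_right_distrib
      env.scale_left_distrib env.scale_scale env.scale_one simp_thms)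
qed


section \<open>The twisting maps and the deformation\<close>

text \<open>The two uniqueness statements justify the definite descriptions that follow.  The second
  map has values in power series; the scalars \<open>c\<close> then act coefficientwise.\<close>

lemma env_twist_ex1:
  "\<exists>!f. module_hom env_scale env_scale f \<and>
    (\<forall>m n. f (env_basis m n) = env_scale (k ^ m) (env_basis m n :: 'k::field env_alg))"
proof (rule ex_ex1I)
  define h where "h c = env_scale (c::'k) 1" for c
  define g where "g a = (case a of gen_x \<Rightarrow> env_gen gen_x :: 'k env_alg
    | gen_y \<Rightarrow> env_scale k (env_gen gen_y))" for a
  interpret free_alg_hom h g
  proof
    fix c d :: 'k and a :: "'k env_alg"
    show "h (c + d) = h c + h d" by (simp add: h_def env.scale_left_distrib)
    show "h (c * d) = h c * h d" by (simp add: h_def flip: env_scale_left)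
    show "h 1 = 1" by (simp add: h_def)
    show "h c * a = a * h c" by (simp add: h_def flip: env_scale_left env_scale_right)
    show "g gen_x * g gen_y - g gen_y * g gen_x - g gen_y = 0"
      by (simp add: g_def env_relation flip: env_scale_left env_scale_right
          env.scale_right_diff_distrib)
  qed
  have hs: "module_hom env_scale env_scale hom"
    by (intro module_hom.intro module_env_scale module_hom_axioms.intro)
      (simp_all add: hom_add hom_scale h_def flip: env_scale_left)
  have pow: "env_scale k a ^ m = env_scale (k ^ m) (a ^ m)" for m and a :: "'k env_alg"
    by (induction m) (simp_all add: ac_simps flip: env_scale_left env_scale_right)
  have "hom (env_basis m n) = env_scale (k ^ m) (env_basis m n)" for m n
    by (simp add: env_basis_def hom_mult hom_power hom_gen g_def pow env_scale_left)
  with hs show "\<exists>f. module_hom env_scale env_scale f \<and>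
    (\<forall>m n. f (env_basis m n) = env_scale (k ^ m) (env_basis m n :: 'k env_alg))" by blast
qed (elim conjE, rule env_ext, assumption+, simp)

lemma env_twist_fps_ex1:
  "\<exists>!F. module_hom env_scale (\<lambda>c. fps_scale env_scale (fps_const c)) F \<and>
    (\<forall>m n. F (env_basis m n :: 'k::field env_alg) =
      fps_scale env_scale ((1 + fps_X) ^ m) (fps_const (env_basis m n)))"
proof (rule ex_ex1I)
  define h where "h c = fps_const (env_scale (c::'k) 1)" for c
  define g where "g a = (case a of gen_x \<Rightarrow> fps_const (env_gen gen_x :: 'k env_alg)
    | gen_y \<Rightarrow> (1 + fps_X) * fps_const (env_gen gen_y))" for a
  have c: "(1 + fps_X) * a = a * (1 + fps_X)" for a :: "'k env_alg fps"
    by (simp add: algebra_simps fps_mult_fps_X_commute)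
  have c': "b * ((1 + fps_X) * a) = (1 + fps_X) * (b * a)" for a b :: "'k env_alg fps"
    by (simp only: c[of b] mult.assoc[symmetric])
  interpret free_alg_hom h g
  proof
    fix c d :: 'k and a :: "'k env_alg fps"
    show "h (c + d) = h c + h d" by (simp add: h_def env.scale_left_distrib)
    show "h (c * d) = h c * h d" by (simp add: h_def flip: env_scale_left)
    show "h 1 = 1" by (simp add: h_def)
    show "h c * a = a * h c" by (simp add: h_def fps_eq_iff flip: env_scale_left env_scale_right)
    have "g gen_x * g gen_y - g gen_y * g gen_x - g gen_y =
      (1 + fps_X) * (fps_const (env_gen gen_x) * fps_const (env_gen gen_y)
        - fps_const (env_gen gen_y) * fps_const (env_gen gen_x) - fps_const (env_gen gen_y))"
      by (simp only: g_def generator.case right_diff_distrib mult.assoc c')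
    also have "\<dots> = 0" using env_relation[where 'k='k] by (simp add: fps_const_sub)
    finally show "g gen_x * g gen_y - g gen_y * g gen_x - g gen_y = 0" .
  qed
  have hs: "module_hom env_scale (\<lambda>c. fps_scale env_scale (fps_const c)) hom"
    by (intro module_hom.intro module_env_scale module_fps_const module_hom_axioms.intro)
      (simp_all add: hom_add hom_scale h_def fps_const_scale fps_eq_iff flip: env_scale_left)
  have p: "Abs_fps (\<lambda>i. env_scale ((1 + fps_X) ^ m $ i) 1) = (1 + fps_X :: 'k env_alg fps) ^ m" for m
  proof (induction m)
    case 0
    show ?case by (simp add: fps_eq_iff)
  next
    case (Suc m)
    have "Abs_fps (\<lambda>i. env_scale (((1 + fps_X) * (1 + fps_X) ^ m) $ i) 1) = 
      (1 + fps_X) * Abs_fps (\<lambda>i. env_scale ((1 + fps_X) ^ m $ i) (1::'k env_alg))"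
      by (simp add: fps_eq_iff distrib_right env.scale_left_distrib)
    then show ?case using Suc by simp
  qed
  have pow: "((1 + fps_X) * a) ^ m = (1 + fps_X) ^ m * a ^ m" for m and a :: "'k env_alg fps"
  proof (induction m)
    case (Suc m)
    have "(1 + fps_X) ^ m * a = a * (1 + fps_X) ^ m"
      by (rule power_commuting_commutes) (rule c)
    then have "a * ((1 + fps_X) ^ m * b) = (1 + fps_X) ^ m * (a * b)" for b
      by (simp only: mult.assoc[symmetric])
    then show ?case by (simp only: power_Suc Suc mult.assoc)
  qed simp
  have "hom (env_basis m n) = fps_scale env_scale ((1 + fps_X) ^ m) (fps_const (env_basis m n))" for m n
    unfolding fps_scale_mult p
    by (simp add: env_basis_def hom_mult hom_power hom_gen g_def pow mult.assoc fps_const_power)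
  with hs show "\<exists>F. module_hom env_scale (\<lambda>c. fps_scale env_scale (fps_const c)) F \<and>
    (\<forall>m n. F (env_basis m n :: 'k env_alg) =
      fps_scale env_scale ((1 + fps_X) ^ m) (fps_const (env_basis m n)))" by blast
qed (elim conjE, rule env_ext, assumption+, simp)

definition env_twist :: "'k::field \<Rightarrow> 'k env_alg \<Rightarrow> 'k env_alg"
  where "env_twist k = (THE f. module_hom env_scale env_scale f \<and>
    (\<forall>m n. f (env_basis m n) = env_scale (k ^ m) (env_basis m n)))"

definition env_hom_mult :: "'k::field \<Rightarrow> 'k env_alg \<Rightarrow> 'k env_alg \<Rightarrow> 'k env_alg"
  where "env_hom_mult k a b = env_twist k (a * b)"

definition env_twist_fps :: "'k::field env_alg \<Rightarrow> 'k env_alg fps"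
  where "env_twist_fps = (THE F. module_hom env_scale (\<lambda>c. fps_scale env_scale (fps_const c)) F \<and>
    (\<forall>m n. F (env_basis m n) =
      fps_scale env_scale ((1 + fps_X) ^ m) (fps_const (env_basis m n))))"

definition env_hom_mult_fps :: "'k::field env_alg \<Rightarrow> 'k env_alg \<Rightarrow> 'k env_alg fps"
  where "env_hom_mult_fps a b = env_twist_fps (a * b)"

lemmas env_twist = theI'[OF env_twist_ex1, folded env_twist_def]
lemmas env_twist_fps = theI'[OF env_twist_fps_ex1, folded env_twist_fps_def]

text \<open>Substituting \<open>t = s\<close> in the power series recovers the twisting map for \<open>k = 1 + s\<close>.\<close>

lemma env_twist_specialize:
  fixes u :: "'k::field env_alg"
  shows "finite {i. env_twist_fps u $ i \<noteq> 0}"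
    and "env_twist (1 + s) u = (\<Sum>i. env_scale (s ^ i) (env_twist_fps u $ i))"
proof -
  interpret F: module_hom env_scale "\<lambda>c. fps_scale env_scale (fps_const c)"
    "env_twist_fps :: 'k env_alg \<Rightarrow> _" using env_twist_fps by blast
  interpret f: module_hom env_scale env_scale "env_twist (1 + s)"
    using env_twist by blast
  have binom: "(1 + fps_X :: 'k fps) ^ m $ i = of_nat (m choose i)" for m i
  proof (induction m arbitrary: i)
    case 0
    show ?case by (cases i) simp_all
  next
    case (Suc m)
    then show ?case by (cases i) (simp_all add: distrib_right add.commute)
  qed
  have coeffs: "env_twist_fps (env_basis m n :: 'k env_alg) $ i =
      env_scale (of_nat (m choose i)) (env_basis m n)" for m n i
  proof -
    have "env_twist_fps (env_basis m n :: 'k env_alg) $ i =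
        (\<Sum>j\<le>i. env_scale (of_nat (m choose j)) (fps_const (env_basis m n) $ (i - j)))"
      by (simp only: conjunct2[OF env_twist_fps, rule_format] fps_scale_def fps_nth_Abs_fps binom)
    also have "\<dots> = (\<Sum>j\<in>{i}. env_scale (of_nat (m choose j)) (fps_const (env_basis m n) $ (i - j)))"
      by (rule sum.mono_neutral_right) auto
    finally show ?thesis by simp
  qed
  have vanish: "env_twist_fps (env_scale c (env_basis m n) :: 'k env_alg) $ i = 0"
    if "m < i" for c m n i
    using that by (simp add: F.scale fps_const_scale coeffs binomial_eq_0)
  have fin: "finite {i. env_twist_fps u $ i \<noteq> 0}" for u :: "'k env_alg"
    using env_span[of u]
  proof (induction rule: env_span.induct)
    case (basis c m n)
    show ?case
      by (rule finite_subset[of _ "{..m}"])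
        (use vanish in \<open>auto simp flip: not_less\<close>)
  next
    case (add u v)
    show ?case
      by (rule finite_subset[OF _ finite_UnI[OF add.IH]]) (auto simp: F.add)
  qed
  then show "finite {i. env_twist_fps u $ i \<noteq> 0}" .
  have fin': "finite {i. env_scale (s ^ i) (env_twist_fps u $ i) \<noteq> 0}" for u
    by (rule finite_subset[OF _ fin[of u]]) auto
  show "env_twist (1 + s) u = (\<Sum>i. env_scale (s ^ i) (env_twist_fps u $ i))"
    using env_span[of u]
  proof (induction rule: env_span.induct)
    case (basis c m n)
    have "(\<Sum>i. env_scale (s ^ i) (env_twist_fps (env_scale c (env_basis m n)) $ i)) =
        (\<Sum>i\<le>m. env_scale (s ^ i) (env_twist_fps (env_scale c (env_basis m n)) $ i))"
      by (rule Sum_any.expand_superset)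
        (use vanish in \<open>auto simp flip: not_less\<close>)
    also have "\<dots> = env_scale (\<Sum>i\<le>m. s ^ i * (c * of_nat (m choose i))) (env_basis m n)"
      by (simp add: F.scale fps_const_scale coeffs env.scale_sum_left)
    also have "(\<Sum>i\<le>m. s ^ i * (c * of_nat (m choose i))) = c * (s + 1) ^ m"
      unfolding binomial_ring sum_distrib_left by (intro sum.cong) (simp_all add: ac_simps)
    also have "env_scale (c * (s + 1) ^ m) (env_basis m n) =
        env_twist (1 + s) (env_scale c (env_basis m n))"
      using env_twist[of "1 + s"] by (simp add: f.scale add.commute)
    finally show ?case by simp
  next
    case (add u v)
    then show ?case
      by (simp add: f.add F.add env.scale_right_distrib Sum_any.distrib[OF fin' fin'])
  qed
qed

end

theory Submission
  imports Defs
begin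

text \<open>The twisting map \<open>\<alpha>\<^sub>t\<close> is a ring endomorphism of \<open>U(L)[[t]]\<close>, because \<open>xy - yx - y\<close> is
  homogeneous in \<open>y\<close>.  Hence \<open>[a, b]\<^sub>t = \<alpha>\<^sub>t(ab - ba)\<close> is the Yau twist of an ordinary commutator, and
  \<open>[\<alpha>\<^sub>t(a), [b, c]\<^sub>t]\<^sub>t = \<alpha>\<^sub>t\<^sup>2([a, [b, c]])\<close>, so that the hom-Jacobi identity is the image under \<open>\<alpha>\<^sub>t\<^sup>2\<close>
  of the Jacobi identity.\<close>

text \<open>Stated for an arbitrary ring with a compatible scalar action so that it serves twice:
  with \<open>f = id\<close> for U(L) over K, and with the extended twist for U(L)[[t]] over
  K[[t]].\<close>

lemma hom_lie_algebra_twisted_commutator: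
  fixes s :: "'r::comm_ring_1 \<Rightarrow> 'a::ring_1 \<Rightarrow> 'a"
  assumes f: "module_hom s s f"
    and left: "\<And>c a b. s c (a * b) = s c a * b"
    and right: "\<And>c a b. s c (a * b) = a * s c b"
    and mult: "\<And>a b. f (a * b) = f a * f b"
  shows "hom_lie_algebra s (commutator (\<lambda>a b. f (a * b))) f"
proof -
  interpret f: module_hom s s f by fact
  show ?thesis
  proof
    show "commutator (\<lambda>a b. f (a * b)) (x + y) v =
        commutator (\<lambda>a b. f (a * b)) x v + commutator (\<lambda>a b. f (a * b)) y v" for x y v
      by (simp add: commutator_def algebra_simps f.add)
    show "commutator (\<lambda>a b. f (a * b)) u (x + y) =
        commutator (\<lambda>a b. f (a * b)) u x + commutator (\<lambda>a b. f (a * b)) u y" for x y u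
      by (simp add: commutator_def algebra_simps f.add)
    show "commutator (\<lambda>a b. f (a * b)) (s c x) v = s c (commutator (\<lambda>a b. f (a * b)) x v)" for c x v
      by (simp add: commutator_def f.scale f.m1.scale_right_diff_distrib flip: left right)
    show "commutator (\<lambda>a b. f (a * b)) u (s c x) = s c (commutator (\<lambda>a b. f (a * b)) u x)" for c x u
      by (simp add: commutator_def f.scale f.m1.scale_right_diff_distrib flip: left right)
    show "commutator (\<lambda>a b. f (a * b)) u u = 0" for u
      by (simp add: commutator_def)
    show "commutator (\<lambda>a b. f (a * b)) (f u) (commutator (\<lambda>a b. f (a * b)) v w) +
        commutator (\<lambda>a b. f (a * b)) (f w) (commutator (\<lambda>a b. f (a * b)) u v) +
        commutator (\<lambda>a b. f (a * b)) (f v) (commutator (\<lambda>a b. f (a * b)) w u) = 0" for u v w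
      \<comment> \<open>Pushing \<open>f\<close> inwards leaves twelve signed products of
        \<open>f (f u)\<close>, \<open>f (f v)\<close> and \<open>f (f w)\<close>, which cancel in
        pairs by associativity.\<close>
      by (simp add: commutator_def mult f.diff algebra_simps)
  qed
qed


section \<open>Homogeneous extensions\<close>

lemma hom_ext_add:
  assumes "\<And>a b. F (a + b) = F a + F b"
  shows "hom_ext F (u + v) = hom_ext F u + hom_ext F v"
  by (simp add: fps_eq_iff hom_ext_def assms sum.distrib)

text \<open>A Horner step: splitting off the constant term expresses each coefficient through an
  earlier one of the shifted series. The inductions on the coefficient index below rest on
  it.\<close>

lemma hom_ext_shift:
  "hom_ext F u = F (u $ 0) + fps_X * hom_ext F (fps_shift 1 u)"
  for F :: "'a::ring_1 \<Rightarrow> 'a fps"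
proof (rule fps_ext)
  fix n
  show "hom_ext F u $ n = (F (u $ 0) + fps_X * hom_ext F (fps_shift 1 u)) $ n"
    by (cases n) (simp_all add: hom_ext_def sum.atMost_Suc_shift del: sum.atMost_Suc)
qed

lemma fps_decompose: "u = fps_const (u $ 0) + fps_X * fps_shift 1 u" for u :: "'a::ring_1 fps"
proof (rule fps_ext)
  fix n show "u $ n = (fps_const (u $ 0) + fps_X * fps_shift 1 u) $ n" by (cases n) simp_all
qed

lemma hom_ext_const_mult:
  fixes F :: "'a::ring_1 \<Rightarrow> 'a fps"
  assumes mult: "\<And>a b. F (a * b) = F a * F b"
  shows "hom_ext F (fps_const a * v) = F a * hom_ext F v"
proof (rule fps_ext)
  fix n show "hom_ext F (fps_const a * v) $ n = (F a * hom_ext F v) $ n"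
  proof (induction n arbitrary: v rule: less_induct)
    case (less n)
    have shift: "fps_shift 1 (fps_const a * v) = fps_const a * fps_shift 1 v"
      by (simp add: fps_eq_iff)
    \<comment> \<open>\<open>fps_X\<close> is central even though the coefficients need not
      commute.\<close>
    have "F a * (fps_X * w) = fps_X * (F a * w)" for w
      by (simp only: mult.assoc[symmetric] fps_mult_fps_X_commute[of "F a"])
    then have "F a * hom_ext F v = F (a * v $ 0) + fps_X * (F a * hom_ext F (fps_shift 1 v))"
      by (subst hom_ext_shift) (simp add: mult distrib_left)
    moreover have "hom_ext F (fps_const a * v) =
        F (a * v $ 0) + fps_X * hom_ext F (fps_const a * fps_shift 1 v)"
      by (subst hom_ext_shift) (simp only: shift fps_mult_left_const_nth)
    ultimately show ?case using less by (cases n) simp_all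
  qed
qed

text \<open>Peeling off the constant term of \<open>u\<close> leaves a constant left factor, settled
  by \<open>hom_ext_const_mult\<close>, and a multiple of \<open>fps_X\<close>, where the induction
  hypothesis applies one index lower.\<close>

lemma hom_ext_mult:
  fixes F :: "'a::ring_1 \<Rightarrow> 'a fps"
  assumes add: "\<And>a b. F (a + b) = F a + F b"
    and mult: "\<And>a b. F (a * b) = F a * F b"
  shows "hom_ext F (u * v) = hom_ext F u * hom_ext F v"
proof (rule fps_ext)
  have X: "hom_ext F (fps_X * w) = fps_X * hom_ext F w" for w
  proof -
    have "F 0 = 0" using add[of 0 0] by simp
    moreover have "fps_shift 1 (fps_X * w) = w" by (simp add: fps_eq_iff)
    ultimately show ?thesis by (subst hom_ext_shift) simp
  qed
  fix n show "hom_ext F (u * v) $ n = (hom_ext F u * hom_ext F v) $ n"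
  proof (induction n arbitrary: u rule: less_induct)
    case (less n)
    have "u * v = fps_const (u $ 0) * v + fps_X * (fps_shift 1 u * v)"
      by (subst fps_decompose[of u]) (simp only: distrib_right mult.assoc)
    then have "hom_ext F (u * v) = F (u $ 0) * hom_ext F v + fps_X * hom_ext F (fps_shift 1 u * v)"
      by (simp only: hom_ext_add[OF add] hom_ext_const_mult[OF mult] X)
    moreover have "hom_ext F u * hom_ext F v =
        F (u $ 0) * hom_ext F v + fps_X * (hom_ext F (fps_shift 1 u) * hom_ext F v)"
      by (subst hom_ext_shift) (simp only: distrib_right mult.assoc)
    ultimately show ?case using less by (cases n) simp_all
  qed
qed

text \<open>This identifies the extended product with the twist of the Cauchy product, the form that
  the twisted commutator lemma requires.\<close>

lemma hom_ext2_mult: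
  fixes F :: "'a::ring_1 \<Rightarrow> 'a fps"
  assumes add: "\<And>a b. F (a + b) = F a + F b"
  shows "hom_ext2 (\<lambda>a b. F (a * b)) u v = hom_ext F (u * v)"
proof (rule fps_ext)
  fix n
  have "F 0 = 0" using add[of 0 0] by simp
  have sum: "F (sum g A) = (\<Sum>a\<in>A. F (g a))" if "finite A" for g and A :: "nat set"
    using that by (induction A rule: finite_induct) (simp_all add: add \<open>F 0 = 0\<close>)
  have "hom_ext F (u * v) $ n = (\<Sum>k\<le>n. \<Sum>i\<le>k. F (u $ i * v $ (k - i)) $ (n - k))"
    by (simp add: hom_ext_def fps_mult_nth atLeast0AtMost sum fps_sum_nth)
  \<comment> \<open>The substitution \<open>k = i + l\<close> matches the pairs with
    \<open>i \<le> k \<le> n\<close> to those with \<open>i + l \<le> n\<close>.\<close>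
  also have "\<dots> = (\<Sum>i\<le>n. \<Sum>l\<le>n - i. F (u $ i * v $ l) $ (n - i - l))"
    unfolding sum.Sigma[OF finite_atMost ballI[OF finite_atMost]]
    by (rule sum.reindex_bij_witness[of _ "\<lambda>(i, l). (i + l, i)" "\<lambda>(k, i). (i, k - i)"]) auto
  finally show "hom_ext2 (\<lambda>a b. F (a * b)) u v $ n = hom_ext F (u * v) $ n"
    by (simp add: hom_ext2_def)
qed

lemma hom_ext2_swap: "hom_ext2 (\<lambda>a b. B b a) u v = hom_ext2 B v u"
proof (rule fps_ext)
  fix n
  have "(\<Sum>j\<le>n. \<Sum>l\<le>n - j. B (v $ l) (u $ j) $ (n - j - l)) =
      (\<Sum>l\<le>n. \<Sum>j\<le>n - l. B (v $ l) (u $ j) $ (n - l - j))"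
    unfolding sum.Sigma[OF finite_atMost ballI[OF finite_atMost]]
    by (rule sum.reindex_bij_witness[of _ prod.swap prod.swap])
      (auto simp: add.commute)
  then show "hom_ext2 (\<lambda>a b. B b a) u v $ n = hom_ext2 B v u $ n"
    by (simp add: hom_ext2_def)
qed

lemma commutator_hom_ext2: "commutator (hom_ext2 B) = hom_ext2 (\<lambda>a b. B a b - B b a)"
proof (intro ext)
  fix u v
  show "commutator (hom_ext2 B) u v = hom_ext2 (\<lambda>a b. B a b - B b a) u v"
    unfolding commutator_def hom_ext2_swap[of B u v, symmetric]
    by (simp add: fps_eq_iff hom_ext2_def sum_subtractf)
qed


section \<open>Scalar power series acting on power series over the enveloping algebra\<close>

text \<open>\<open>fps_scale env_scale f 1\<close> is the image of the scalar series
  \<open>f\<close> in U(L)[[t]]. This lemma and the next two turn the action of K[[t]] into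
  multiplication by central elements.\<close>

lemma fps_scale_one_mult:
  "fps_scale env_scale (f * g) 1 = fps_scale env_scale f 1 * fps_scale env_scale g 1"
  for f g :: "'k::field fps"
  by (simp add: fps_eq_iff fps_scale_mult fps_mult_nth env.scale_sum_left flip: env_scale_left)

lemma fps_scale_one_commute: "fps_scale env_scale f 1 * u = u * fps_scale env_scale f 1"
proof (rule fps_ext)
  fix n
  have "(\<Sum>i=0..n. env_scale (f $ i) (u $ (n - i))) = (\<Sum>i=0..n. env_scale (f $ (n - i)) (u $ i))"
    by (rule sum.reindex_bij_witness[of _ "\<lambda>i. n - i" "\<lambda>i. n - i"]) auto
  then show "(fps_scale env_scale f 1 * u) $ n = (u * fps_scale env_scale f 1) $ n"
    by (simp add: fps_scale_mult fps_mult_nth flip: env_scale_left env_scale_right)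
qed

lemma fps_scale_conv_mult: "fps_scale env_scale f u = fps_scale env_scale f 1 * u"
  by (simp add: fps_scale_mult)

lemma fps_scale_left: "fps_scale env_scale c (a * b) = fps_scale env_scale c a * b"
  by (simp add: fps_scale_mult mult.assoc)

lemma fps_scale_right: "fps_scale env_scale c (a * b) = a * fps_scale env_scale c b"
  unfolding fps_scale_conv_mult[of c b] fps_scale_conv_mult[of c "a * b"]
  by (simp only: mult.assoc[symmetric] fps_scale_one_commute[of c a])

lemma module_fps_scale: "module (fps_scale env_scale :: 'k::field fps \<Rightarrow> _)"
proof
  fix a b :: "'k fps" and x y :: "'k env_alg fps"
  show "fps_scale env_scale a (x + y) = fps_scale env_scale a x + fps_scale env_scale a y"
    by (simp add: fps_scale_mult distrib_left)
  show "fps_scale env_scale (a + b) x = fps_scale env_scale a x + fps_scale env_scale b x"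
    by (simp add: fps_eq_iff fps_scale_def env.scale_left_distrib sum.distrib)
  show "fps_scale env_scale a (fps_scale env_scale b x) = fps_scale env_scale (a * b) x"
    unfolding fps_scale_conv_mult[of "a * b" x] fps_scale_one_mult
    by (simp add: fps_scale_conv_mult[of _ x] fps_scale_conv_mult[of a "_ * x"] mult.assoc)
  show "fps_scale env_scale 1 x = x"
    by (simp add: fps_eq_iff fps_scale_def if_distrib[of "\<lambda>c. env_scale c _"] sum.delta
        cong: if_cong)
qed


section \<open>The twisting map is a ring endomorphism\<close>

interpretation env_twist_fps: module_hom env_scale "\<lambda>c. fps_scale env_scale (fps_const c)"
  "env_twist_fps :: 'k::field env_alg \<Rightarrow> _"
  using env_twist_fps by blast

lemma env_twist_fps_basis:
  "env_twist_fps (env_basis m n) = fps_scale env_scale ((1 + fps_X) ^ m) (fps_const (env_basis m n))"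
  using env_twist_fps by blast

lemma env_twist_fps_one: "env_twist_fps 1 = (1 :: 'k::field env_alg fps)"
proof -
  interpret t: module "fps_scale env_scale :: 'k fps \<Rightarrow> _" by (rule module_fps_scale)
  show ?thesis using env_twist_fps_basis[of 0 0, where 'a='k] by (simp add: env_basis_def)
qed

lemma fps_const_scale_const:
  "fps_scale env_scale (fps_const c) (fps_const u) = fps_const (env_scale c u)"
  by (simp add: fps_const_scale fps_eq_iff)

text \<open>Homogeneity in y enters here: left multiplication by x preserves the y-degree and by y
  raises it by one, so only y contributes a factor 1 + t.\<close>

lemma env_twist_fps_gen_mult:
  "env_twist_fps (env_gen a * u) =
    fps_scale env_scale (case a of gen_x \<Rightarrow> 1 | gen_y \<Rightarrow> 1 + fps_X) (fps_const (env_gen a) * env_twist_fps u)"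
  (is "_ = fps_scale env_scale ?c _")
proof -
  interpret t: module "fps_scale env_scale :: 'a fps \<Rightarrow> _" by (rule module_fps_scale)
  show ?thesis using env_span[of u]
  proof (induction rule: env_span.induct)
    case (basis c m n)
    let ?e = "env_basis m n :: 'a env_alg"
    have "env_twist_fps (env_gen a * ?e) =
        fps_scale env_scale (?c * (1 + fps_X) ^ m) (fps_const (env_gen a * ?e))"
    proof (cases a)
      case gen_x
      \<comment> \<open>Moving x past y^m yields two basis terms, both of y-degree \<open>m\<close>,
        hence both scaled by the same power of 1 + t.\<close>
      have "env_gen gen_x * ?e = env_basis m (Suc n) + env_scale (of_nat m) ?e"
        by (simp add: env_basis_def distrib_right power_Suc mult.assoc gen_x_gen_y_power
          flip: mult.assoc[of "env_gen gen_x"] env_scale_left)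
      moreover have "env_twist_fps (env_basis m (Suc n) + env_scale (of_nat m) ?e) =
          fps_scale env_scale ((1 + fps_X) ^ m)
            (fps_const (env_basis m (Suc n) + env_scale (of_nat m) ?e))"
        by (simp add: env_twist_fps.add env_twist_fps.scale env_twist_fps_basis mult.commute
          t.scale_right_distrib flip: fps_const_add fps_const_scale_const)
      ultimately show ?thesis by (simp add: gen_x)
    next
      case gen_y
      have "env_gen gen_y * ?e = env_basis (Suc m) n"
        by (simp add: env_basis_def mult.assoc)
      then show ?thesis by (simp add: gen_y env_twist_fps_basis)
    qed
    also have "\<dots> = fps_scale env_scale ?c (fps_const (env_gen a) * env_twist_fps ?e)"
      by (simp only: env_twist_fps_basis fps_scale_right[symmetric] t.scale_scale fps_const_mult)
    finally show ?case
      by (simp only: env_scale_right[symmetric] env_twist_fps.scale fps_scale_right[symmetric]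
          t.scale_scale mult.commute)
  next
    case (add u v)
    then show ?case by (simp only: distrib_left env_twist_fps.add t.scale_right_distrib)
  qed
qed

lemma env_twist_fps_mult: "env_twist_fps (a * b) = env_twist_fps a * env_twist_fps b"
proof -
  \<comment> \<open>Quantifying over every right factor makes \<open>S\<close> closed under
    products, so it contains the ordered monomials as soon as it contains the generators and
    1.\<close>
  define S :: "'a env_alg set"
    where "S = {a. \<forall>b. env_twist_fps (a * b) = env_twist_fps a * env_twist_fps b}"
  have gen: "env_gen g \<in> S" for g
  proof -
    have "env_twist_fps (env_gen g :: 'a env_alg) =
        fps_scale env_scale (case g of gen_x \<Rightarrow> 1 | gen_y \<Rightarrow> 1 + fps_X) (fps_const (env_gen g))"
      using env_twist_fps_gen_mult[of g "1 :: 'a env_alg"] by (simp add: env_twist_fps_one)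
    then show ?thesis
      by (simp only: S_def mem_Collect_eq env_twist_fps_gen_mult fps_scale_left simp_thms)
  qed
  have one: "1 \<in> S" by (simp add: S_def env_twist_fps_one)
  have times: "c * d \<in> S" if "c \<in> S" "d \<in> S" for c d
    using that by (simp add: S_def mult.assoc)
  have power: "c ^ n \<in> S" if "c \<in> S" for c n
    by (induction n) (simp_all add: one times that)
  have "a \<in> S" using env_span[of a]
  proof (induction rule: env_span.induct)
    case (basis c m n)
    have "env_basis m n \<in> S" unfolding env_basis_def by (intro times power gen)
    then show ?case
      by (simp add: S_def env_twist_fps.scale fps_scale_left flip: env_scale_left)
  next
    case (add u v)
    then show ?case by (simp add: S_def distrib_right env_twist_fps.add)
  qed
  then show ?thesis by (simp add: S_def)
qed

lemma linear_env_twist_fps_nth: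
  "module_hom env_scale env_scale (\<lambda>u. env_twist_fps u $ i :: 'k::field env_alg)"
  by (intro module_hom.intro module_env_scale module_hom_axioms.intro)
    (simp_all add: env_twist_fps.add env_twist_fps.scale fps_const_scale)

text \<open>Each power of 1 + t has constant term 1, so the deformation starts at the
  identity.\<close>

lemma env_twist_fps_nth_0: "env_twist_fps u $ 0 = u"
proof -
  have "(\<lambda>u. env_twist_fps u $ 0) = (\<lambda>u. u :: 'a env_alg)"
  proof (rule env_ext[OF linear_env_twist_fps_nth env.module_hom_ident])
    show "env_twist_fps (env_basis m n) $ 0 = (env_basis m n :: 'a env_alg)" for m n
      by (simp add: env_twist_fps_basis fps_scale_def fps_power_zeroth)
  qed
  then show ?thesis by (rule fun_cong)
qed

lemma module_hom_hom_ext_env_twist_fps: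
  "module_hom (fps_scale env_scale) (fps_scale env_scale)
    (hom_ext env_twist_fps :: 'k::field env_alg fps \<Rightarrow> _)"
proof (intro module_hom.intro module_fps_scale module_hom_axioms.intro)
  fix c :: "'k fps" and u v :: "'k env_alg fps"
  show "hom_ext env_twist_fps (u + v) = hom_ext env_twist_fps u + hom_ext env_twist_fps v"
    by (rule hom_ext_add) (rule env_twist_fps.add)
  \<comment> \<open>The twist fixes scalars, hence also embedded scalar series; multiplicativity
    then upgrades K-linearity to K[[t]]-linearity.\<close>
  have "env_twist_fps (env_scale d 1) = fps_const (env_scale d (1 :: 'k env_alg))" for d
    by (simp add: env_twist_fps.scale env_twist_fps_one fps_const_scale_const flip: fps_const_1_eq_1)
  then have "hom_ext env_twist_fps (fps_scale env_scale c 1) = fps_scale env_scale c (1 :: 'k env_alg fps)"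
    by (simp add: fps_eq_iff hom_ext_def fps_scale_mult)
  then show "hom_ext env_twist_fps (fps_scale env_scale c u) =
      fps_scale env_scale c (hom_ext env_twist_fps u)"
    unfolding fps_scale_conv_mult[of c u] fps_scale_conv_mult[of c "hom_ext _ _"]
    by (simp add: hom_ext_mult env_twist_fps.add env_twist_fps_mult)
qed

theorem proposition7:
  shows "formal_hom_lie_deformation
    (env_scale :: 'k::field_char_0 \<Rightarrow> 'k env_alg \<Rightarrow> 'k env_alg)
    (commutator (*)) id
    (commutator (hom_ext2 env_hom_mult_fps)) (hom_ext env_twist_fps)"
  unfolding formal_hom_lie_deformation_def
proof (intro conjI)
  have untwisted: "hom_lie_algebra (env_scale :: 'k \<Rightarrow> _) (commutator (*)) id"
    using hom_lie_algebra_twisted_commutator[OF env.module_hom_id env_scale_left env_scale_right]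
    by simp
  then show "hom_lie_algebra (env_scale :: 'k \<Rightarrow> _) (commutator (*)) id" .
  have "hom_ext2 env_hom_mult_fps = (\<lambda>a b. hom_ext env_twist_fps (a * b :: 'k env_alg fps))"
    by (rule ext)+ (simp add: hom_ext2_mult env_twist_fps.add env_hom_mult_fps_def[abs_def])
  then show "hom_lie_algebra (fps_scale (env_scale :: 'k \<Rightarrow> _))
      (commutator (hom_ext2 env_hom_mult_fps)) (hom_ext env_twist_fps)"
    by (simp only:) (intro hom_lie_algebra_twisted_commutator module_hom_hom_ext_env_twist_fps
      fps_scale_left fps_scale_right hom_ext_mult env_twist_fps.add env_twist_fps_mult)
  interpret lie: hom_lie_algebra "env_scale :: 'k \<Rightarrow> _" "commutator (*)" id by (rule untwisted)
  \<comment> \<open>The components come from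
    \<open>[u, v]\<^sub>t = \<alpha>\<^sub>t([u, v]\<^sub>0)\<close> on U(L), read off coefficient
    by coefficient.\<close>
  let ?b = "\<lambda>i (u :: 'k env_alg) v. env_twist_fps (commutator (*) u v) $ i"
  let ?a = "\<lambda>i (u :: 'k env_alg). env_twist_fps u $ i"
  have left: "module_hom env_scale env_scale (\<lambda>u. ?b i u v)" for i v
    using module_hom_compose[OF lie.linear_bracket_left linear_env_twist_fps_nth]
    by (simp add: o_def)
  have right: "module_hom env_scale env_scale (?b i u)" for i u
    using module_hom_compose[OF lie.linear_bracket_right linear_env_twist_fps_nth]
    by (simp add: o_def)
  \<comment> \<open>The commutator passes inside the extension, and additivity of the twist merges
    the two products into the twist of one commutator.\<close>
  have bracket: "commutator (hom_ext2 env_hom_mult_fps) = hom_ext2 (\<lambda>u v. Abs_fps (\<lambda>i. ?b i u v))"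
    unfolding commutator_hom_ext2
    by (simp add: commutator_def[abs_def] env_hom_mult_fps_def fps_nth_inverse flip: env_twist_fps.diff)
  show "\<exists>brackets twists.
      (\<forall>i u. module_hom (env_scale :: 'k \<Rightarrow> _) env_scale (brackets i u)) \<and>
      (\<forall>i v. module_hom (env_scale :: 'k \<Rightarrow> _) env_scale (\<lambda>u. brackets i u v)) \<and>
      (\<forall>i. module_hom (env_scale :: 'k \<Rightarrow> _) env_scale (twists i)) \<and>
      brackets (0::nat) = commutator (*) \<and> twists (0::nat) = id \<and>
      commutator (hom_ext2 env_hom_mult_fps) = hom_ext2 (\<lambda>u v. Abs_fps (\<lambda>i. brackets i u v)) \<and>
      hom_ext env_twist_fps = hom_ext (\<lambda>u. Abs_fps (\<lambda>i. twists i u))"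
    by (rule exI[of _ ?b], rule exI[of _ ?a])
      (auto simp: left right linear_env_twist_fps_nth env_twist_fps_nth_0 bracket fps_nth_inverse)
qed

end
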